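(* Let $\Omega$ be an infinite set. Then every separable topology on $\Omega^\Omega$, with respect to which $\Omega^\Omega$ is a semitopological semigroup, is perfect.
   Context: $\Omega^\Omega$ is the monoid of all functions $\Omega\to\Omega$ under composition. A semigroup $S$ with a topology is semitopological if for every $s\in S$ the maps $x\mapsto xs$ and $x\mapsto sx$ are continuous maps $S\to S$. A topology is separable if it has a countable dense subset, and perfect if it has no isolated points (points $x$ with $\{x\}$ open). *)

theory Defs
  imports "HOL-Analysis.Analysis"
begin

text \<open>
  Topologies are values of type \<^typ>\<open>'a topology\<close> rather than class instances, since the result
  quantifies over all topologies on one and the same semigroup. No separation axiom and no joint
  continuity of the multiplication is required.
\<close>

definition semitopological_semigroup :: "'s topology \<Rightarrow> ('s \<Rightarrow> 's \<Rightarrow> 's) \<Rightarrow> bool" where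
  "semitopological_semigroup X mul \<longleftrightarrow>
     semigroup mul \<and> topspace X = UNIV \<and>
     (\<forall>s. continuous_map X X (\<lambda>x. mul x s) \<and> continuous_map X X (\<lambda>x. mul s x))"

definition separable_topology :: "'s topology \<Rightarrow> bool" where
  "separable_topology X \<longleftrightarrow>
     (\<exists>D. D \<subseteq> topspace X \<and> countable D \<and> X closure_of D = topspace X)"

definition isolated_point_of :: "'s topology \<Rightarrow> 's \<Rightarrow> bool" where
  "isolated_point_of X x \<longleftrightarrow> x \<in> topspace X \<and> openin X {x}"

definition perfect_topology :: "'s topology \<Rightarrow> bool" where
  "perfect_topology X \<longleftrightarrow> (\<nexists>x. isolated_point_of X x)"

end

theory Submission
  imports Defs
begin

text \<open>
  In a separable space every disjoint family of nonempty open sets is countable, so it suffices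
  to build an uncountable such family from an open singleton \<open>{f}\<close>, using that all sets
  \<open>{x. s \<circ> x \<circ> t = f}\<close> are open. If \<open>f\<close> has infinite range, one lets \<open>s\<close> vary with a subset \<open>B\<close>
  of the range, so that \<open>s \<circ> x = f\<close> forces the points with \<open>f\<close>-value in \<open>B\<close> and those with value
  outside \<open>B\<close> into disjoint copies of \<open>\<Omega>\<close>. If \<open>f\<close> has finite range, some fibre \<open>F\<close> is infinite, and
  each function obtained from \<open>f\<close> by giving it a new value on a proper nonempty subset of \<open>F\<close>
  turns out to be isolated as well.
\<close>

lemma uncountable_Pow_infinite:
  assumes "infinite A"
  shows "uncountable (Pow A)"
proof
  assume cP: "countable (Pow A)"
  have "(\<lambda>a. {a}) ` A \<subseteq> Pow A" by auto
  then have "countable ((\<lambda>a. {a}) ` A)"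
    using cP countable_subset by blast
  then have cA: "countable A"
    by (rule countable_image_inj_on) (auto simp: inj_on_def)
  \<comment> \<open>Countability of both sets would let \<open>A\<close> be mapped onto its own
    power set by way of the natural numbers.\<close>
  have "(from_nat_into (Pow A) \<circ> to_nat_on A) ` A = Pow A"
    using to_nat_on_infinite[OF cA assms] range_from_nat_into[OF Pow_not_empty cP]
    by (simp only: image_comp[symmetric] bij_betw_def)
  then show False using Cantors_theorem by blast
qed

lemma separable_topology_countable_disjoint_family:
  assumes "separable_topology X"
    and op: "\<And>i. i \<in> I \<Longrightarrow> openin X (V i)"
    and ne: "\<And>i. i \<in> I \<Longrightarrow> V i \<noteq> {}"
    and dj: "disjoint_family_on V I"
  shows "countable I"
proof -
  obtain D where D: "countable D" "X closure_of D = topspace X"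
    using assms(1) unfolding separable_topology_def by blast
  have "\<exists>d. d \<in> D \<inter> V i" if i: "i \<in> I" for i
  proof -
    obtain x where x: "x \<in> V i" using ne[OF i] by blast
    then have "x \<in> X closure_of D"
      using D(2) openin_subset[OF op[OF i]] by blast
    then show ?thesis
      using x op[OF i] unfolding in_closure_of by blast
  qed
  then obtain d where d: "\<And>i. i \<in> I \<Longrightarrow> d i \<in> D \<inter> V i" by metis
  have "inj_on d I"
    using d dj unfolding inj_on_def disjoint_family_on_def by (metis IntD2 IntI empty_iff)
  moreover have "countable (d ` I)"
    by (rule countable_subset[OF _ D(1)]) (use d in auto)
  ultimately show ?thesis using countable_image_inj_on by blast
qed

lemma openin_two_sided_translate:
  assumes "semitopological_semigroup X mul" "openin X U"
  shows "openin X {x. mul (mul s x) t \<in> U}"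
proof -
  have top: "topspace X = UNIV"
    and "continuous_map X X (mul s)" "continuous_map X X (\<lambda>x. mul x t)"
    using assms(1) unfolding semitopological_semigroup_def by auto
  then have "continuous_map X X (\<lambda>x. mul (mul s x) t)"
    using continuous_map_compose[of X X "mul s" X "\<lambda>x. mul x t"] by (simp add: o_def)
  from openin_continuous_map_preimage[OF this assms(2)] show ?thesis
    by (simp add: top)
qed

lemma two_disjoint_copies:
  assumes "infinite (UNIV :: 'a set)"
  obtains u v :: "'a \<Rightarrow> 'a" where "inj u" "inj v" "\<And>x y. u x \<noteq> v y"
proof -
  obtain h :: "'a + 'a \<Rightarrow> 'a" where "bij_betw h (UNIV <+> UNIV) UNIV"
    using card_of_Plus_infinite1[OF assms card_of_mono1[OF subset_UNIV]]
    unfolding card_of_ordIso[symmetric] by blast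
  then have "inj h" by (simp add: bij_betw_def)
  then show thesis
    by (intro that[of "h \<circ> Inl" "h \<circ> Inr"]) (auto simp: inj_def)
qed

lemma finite_range_if_isolated:
  fixes X :: "('a \<Rightarrow> 'a) topology"
  assumes inf: "infinite (UNIV :: 'a set)"
    and sg: "semitopological_semigroup X (\<circ>)"
    and sep: "separable_topology X"
    and f: "openin X {f}"
  shows "finite (range f)"
proof (rule ccontr)
  assume infr: "infinite (range f)"
  obtain u v :: "'a \<Rightarrow> 'a" where uv: "inj u" "inj v" "\<And>x y. u x \<noteq> v y"
    using two_disjoint_copies[OF inf] by blast
  fix c :: 'a
  define I where "I = Pow (range f - {c})"
  \<comment> \<open>Away from the default value \<open>c\<close>, each \<open>y\<close> has a single
    preimage under \<open>s B\<close>: \<open>u y\<close> if \<open>y \<in> B\<close>, and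
    \<open>v y\<close> otherwise. Sets in \<open>I\<close> avoid \<open>c\<close>, whose preimages
    are not controlled.\<close>
  define s where "s B z = (if z \<in> u ` B then inv u z else if z \<in> v ` (- B) then inv v z else c)"
    for B z
  define V where "V B = {x. s B \<circ> x = f}" for B
  have "openin X (V B)" for B
    using openin_two_sided_translate[OF sg f, of "s B" id] by (simp add: V_def)
  moreover have "V B \<noteq> {}" for B
  proof -
    have "(\<lambda>p. if f p \<in> B then u (f p) else v (f p)) \<in> V B"
      using uv uv(3)[symmetric] by (auto simp: V_def s_def fun_eq_iff)
    then show ?thesis by blast
  qed
  moreover have "disjoint_family_on V I"
  proof -
    \<comment> \<open>At a point \<open>p\<close> with \<open>f p = y\<close>, membership in
      \<open>V B\<close> forces \<open>x p = u y\<close>, while membership in \<open>V B'\<close>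
      forces \<open>x p = v y\<close>.\<close>
    have False if B: "B \<in> I" and x: "x \<in> V B" "x \<in> V B'" and y: "y \<in> B" "y \<notin> B'" for B B' x y
    proof -
      obtain p where p: "y = f p" and c: "y \<noteq> c" using B y by (auto simp: I_def)
      have "s B (x p) = y" "s B' (x p) = y"
        using x p by (auto simp: V_def fun_eq_iff)
      then show False
        using c y uv uv(3)[symmetric] by (auto simp: s_def dest: injD split: if_splits)
    qed
    then show ?thesis
      unfolding disjoint_family_on_def by blast
  qed
  ultimately have "countable I"
    by (intro separable_topology_countable_disjoint_family[OF sep])
  then show False
    using uncountable_Pow_infinite[of "range f - {c}"] infr by (simp add: I_def)
qed

lemma infinite_range_if_isolated:
  fixes X :: "('a \<Rightarrow> 'a) topology"
  assumes inf: "infinite (UNIV :: 'a set)"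
    and sg: "semitopological_semigroup X (\<circ>)"
    and sep: "separable_topology X"
    and f: "openin X {f}"
  shows "infinite (range f)"
proof
  assume finr: "finite (range f)"
  obtain a where "infinite {p \<in> UNIV. f p = f a}"
    using pigeonhole_infinite[OF inf finr] by blast
  then obtain F c where F: "F = {p. f p = c}" "infinite F" by simp
  obtain q where q: "q \<notin> range f" using finr inf ex_new_if_finite by blast
  have mem: "p \<in> F \<longleftrightarrow> f p = c" and fq: "f p \<noteq> q" for p
    using F(1) q by auto
  \<comment> \<open>Leaving out \<open>{}\<close> and \<open>F\<close> provides points
    \<open>b\<close> in \<open>B\<close> and \<open>b'\<close> in \<open>F - B\<close>, onto which
    the other part of \<open>F\<close> can be collapsed.\<close>
  define I where "I = Pow F - {{}, F}"
  define g where "g B p = (if p \<in> F - B then q else f p)" for B p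
  have "openin X {g B}" if B: "B \<in> I" for B
  proof -
    obtain b b' where b: "B \<subseteq> F" "b \<in> B" "b' \<in> F - B" using B by (auto simp: I_def)
    \<comment> \<open>As \<open>t\<close> fixes every point outside \<open>F - B\<close>, the
      equation \<open>x \<circ> t = f\<close> gives \<open>x = f\<close> there. On
      \<open>F - B\<close>, where \<open>t'\<close> is the identity,
      \<open>s \<circ> x \<circ> t' = f\<close> gives \<open>s (x p) = c\<close>, hence
      \<open>x p = q\<close>, since \<open>s\<close> swaps \<open>c\<close> and \<open>q\<close>.
      Conversely, \<open>g B\<close> solves both equations because \<open>f\<close> is constant on
      \<open>F\<close> and never takes the value \<open>q\<close>.\<close>
    define t where "t p = (if p \<in> F - B then b else p)" for p
    define t' where "t' p = (if p \<in> B then b' else p)" for p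
    define s where "s z = (if z = c then q else if z = q then c else z)" for z
    have "x = g B" if x: "x \<circ> t = f" "s \<circ> x \<circ> t' = f" for x
    proof
      fix p
      have "x (t p) = f p" "s (x (t' p)) = f p"
        using x by (auto simp: fun_eq_iff)
      then show "x p = g B p"
        using b mem[of p] fq[of p]
        by (cases "p \<in> F"; cases "p \<in> B") (auto simp: t_def t'_def s_def g_def split: if_splits)
    qed
    moreover have "g B \<circ> t = f" "s \<circ> g B \<circ> t' = f"
      using b mem fq mem[of b] mem[of b']
      by (auto simp: fun_eq_iff t_def t'_def s_def g_def)
    ultimately have eq: "{g B} = {x. id \<circ> x \<circ> t \<in> {f}} \<inter> {x. s \<circ> x \<circ> t' \<in> {f}}"
      unfolding id_comp by blast
    show ?thesis
      unfolding eq by (intro openin_Int openin_two_sided_translate[OF sg f])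
  qed
  moreover have "disjoint_family_on (\<lambda>B. {g B}) I"
  proof -
    \<comment> \<open>\<open>B\<close> can be recovered from \<open>g B\<close>, so distinct sets
      give distinct isolated points.\<close>
    have "B = {p \<in> F. g B p \<noteq> q}" if "B \<in> I" for B
      using that q by (auto simp: I_def g_def)
    then show ?thesis
      unfolding disjoint_family_on_def by (metis Int_emptyI singletonD)
  qed
  ultimately have "countable I"
    by (intro separable_topology_countable_disjoint_family[OF sep, of I "\<lambda>B. {g B}"]) simp_all
  then have "countable (I \<union> {{}, F})" by simp
  then have "countable (Pow F)" by (rule countable_subset[rotated]) (auto simp: I_def)
  then show False using uncountable_Pow_infinite F(2) by blast
qed

theorem corollary4p5:
  fixes X :: "('a \<Rightarrow> 'a) topology"
  assumes "infinite (UNIV :: 'a set)"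
    and "semitopological_semigroup X (\<circ>)"
    and "separable_topology X"
  shows "perfect_topology X"
  using finite_range_if_isolated[OF assms] infinite_range_if_isolated[OF assms]
  unfolding perfect_topology_def isolated_point_of_def by blast

end
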